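(* Let $q\in\mathbb{C}$ with $0<|q|<1$, and let $b,c\in\mathbb{C}\setminus\{0\}$ be such that none of $b$, $c$, $bc$ is of the form $q^n$ with $n\in\mathbb{Z}$. Then $$\left\{ \frac{1}{2} + \sum_{r\geq 0} \frac{bq^r}{1-bq^r} - \sum_{r\geq 1} \frac{b^{-1}q^r}{1-b^{-1}q^r}+ \sum_{r\geq 0} \frac{cq^r}{1-cq^r} - \sum_{r\geq 1} \frac{c^{-1}q^r}{1-c^{-1}q^r}-\sum_{r\geq 0} \frac{bcq^r}{1-bcq^r} + \sum_{r\geq 1} \frac{b^{-1}c^{-1}q^r}{1-b^{-1}c^{-1}q^r} \right\}^2$$ $$=\frac{1}{4} + \sum_{r \geq 0} \left\{ \frac{bq^r}{(1-bq^r)^2} + \frac{cq^r}{(1-cq^r)^2} +\frac{bcq^r}{(1-bcq^r)^2} \right\} + \sum_{r \geq 1} \left\{ \frac{b^{-1}q^r}{(1-b^{-1}q^r)^2} + \frac{c^{-1}q^r}{(1-c^{-1}q^r)^2} +\frac{b^{-1}c^{-1}q^r}{(1-b^{-1}c^{-1}q^r)^2} \right\} -6 \sum_{r \geq 1} \frac{q^r}{(1-q^r)^2}.$$ *)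

theory Defs
  imports "HOL-Analysis.Analysis"
begin

end

theory Submission
  imports Defs "HOL-Complex_Analysis.Cauchy_Integral_Formula"
begin

text \<open>
  The identity is a multiplicative form of
  \<open>(\<zeta>(u) + \<zeta>(v) - \<zeta>(u + v))\<^sup>2 = P(u) + P(v) + P(u + v)\<close>. For fixed \<open>c\<close>, the difference
  of its two sides is invariant under \<open>b \<mapsto> q b\<close> and under \<open>b \<mapsto> 1 / (b c)\<close>. An expansion at
  \<open>b = 1\<close> shows that it tends to 0 there, hence, by the two invariances, at every point where it
  is not defined. So it extends to a holomorphic function on the punctured plane that is bounded
  by its values on the annulus \<open>\<bar>q\<bar> \<le> \<bar>z\<bar> \<le> 1\<close>. Composing with \<open>exp\<close> and applying Liouville's
  theorem, it is constant, namely 0.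
\<close>

locale nome =
  fixes q :: complex
  assumes q_nonzero [simp]: "q \<noteq> 0" and norm_q_less: "norm q < 1"
begin

section \<open>Lambert series, convergence and differentiation\<close>

definition lambert :: "complex \<Rightarrow> complex" where
  "lambert x = (\<Sum>r. x * q ^ r / (1 - x * q ^ r))"

text \<open>The termwise derivative of \<open>lambert\<close>; hence \<open>x * lambert' x\<close>
  is the series with squared denominators that occurs in the theorem.\<close>

definition lambert' :: "complex \<Rightarrow> complex" where
  "lambert' x = (\<Sum>r. q ^ r / (1 - x * q ^ r) ^ 2)"

definition lambert_dom :: "complex set" where
  "lambert_dom = {x. \<forall>r. x * q ^ r \<noteq> 1}"

definition powers :: "complex set" where
  "powers = range (\<lambda>n::int. q powi n)"

lemma eventually_norm_mult_power_less:
  assumes "e > 0"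
  shows "eventually (\<lambda>r. R * norm q ^ r < e) sequentially"
proof -
  have "(\<lambda>r. R * norm q ^ r) \<longlonglongrightarrow> R * 0"
    using norm_q_less by (intro tendsto_mult tendsto_const LIMSEQ_power_zero) auto
  then show ?thesis
    using assms order_tendstoD(2) by fastforce
qed

text \<open>On a ball of radius 1, \<open>y * q ^ r\<close> has norm below 1 for all large
  \<open>r\<close>, so only finitely many of the conditions cut anything out of the ball, and each
  of these is open.\<close>

lemma open_lambert_dom [simp]: "open lambert_dom"
proof (subst open_subopen, intro ballI)
  fix x assume x: "x \<in> lambert_dom"
  obtain N where N: "\<And>r. r \<ge> N \<Longrightarrow> (norm x + 1) * norm q ^ r < 1"
    using eventually_norm_mult_power_less[of 1] by (auto simp: eventually_sequentially)
  define T where "T = ball x 1 \<inter> (\<Inter>r\<in>{..<N}. {y. y * q ^ r \<noteq> 1})"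
  have "open T"
    unfolding T_def by (intro open_Int open_ball open_INT finite_lessThan ballI open_Collect_neq continuous_intros)
  moreover have "x \<in> T"
    using x by (auto simp: T_def lambert_dom_def)
  moreover have "y * q ^ r \<noteq> 1" if "y \<in> T" for y r
  proof (cases "r < N")
    case False
    have "norm y \<le> norm x + 1"
      using that norm_triangle_sub[of y x] by (auto simp: T_def dist_norm norm_minus_commute)
    then have "norm (y * q ^ r) \<le> (norm x + 1) * norm q ^ r"
      by (simp add: norm_mult norm_power mult_right_mono)
    also have "\<dots> < 1" using False N by simp
    finally show ?thesis by auto
  qed (use that in \<open>auto simp: T_def\<close>)
  ultimately show "\<exists>T. open T \<and> x \<in> T \<and> T \<subseteq> lambert_dom"
    by (auto simp: lambert_dom_def)
qed

text \<open>Local domination by a geometric series allows termwise differentiation. The functions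
  \<open>g\<close>, \<open>g'\<close> obtained that way equal \<open>lambert\<close>,
  \<open>lambert'\<close> by uniqueness of sums.\<close>

lemma lambert_sums_and_deriv:
  assumes "x \<in> lambert_dom"
  shows "(\<lambda>r. x * q ^ r / (1 - x * q ^ r)) sums lambert x"
    and "(\<lambda>r. q ^ r / (1 - x * q ^ r) ^ 2) sums lambert' x"
    and "(lambert has_field_derivative lambert' x) (at x)"
proof -
  let ?f = "\<lambda>r x. x * q ^ r / (1 - x * q ^ r)"
  let ?f' = "\<lambda>r x. q ^ r / (1 - x * q ^ r) ^ 2"
  have "\<exists>g g'. \<forall>x \<in> lambert_dom. ((\<lambda>r. ?f r x) sums g x) \<and> ((\<lambda>r. ?f' r x) sums g' x) \<and>
      (g has_field_derivative g' x) (at x)"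
  proof (rule series_and_derivative_comparison_complex[OF open_lambert_dom])
    fix r x assume "x \<in> lambert_dom"
    then show "(?f r has_field_derivative ?f' r x) (at x)"
      by (auto simp: lambert_dom_def field_simps power2_eq_square intro!: derivative_eq_intros)
  next
    fix x assume "x \<in> lambert_dom"
    define R where "R = norm x + 1"
    \<comment> \<open>The factor 2 bounds the reciprocal of the denominator, which has norm at least
      1/2 as soon as \<open>R * norm q ^ r < 1/2\<close>.\<close>
    define h where "h = (\<lambda>r. complex_of_real (2 * R * norm q ^ r))"
    have R: "R \<ge> 0" by (simp add: R_def)
    have "summable h"
      unfolding h_def summable_of_real_iff
      using norm_q_less by (intro summable_mult summable_geometric) auto
    moreover have "range h \<subseteq> \<real>\<^sub>\<ge>\<^sub>0"
      using R by (auto simp: h_def)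
    moreover have "\<forall>\<^sub>F r in sequentially. \<forall>y\<in>ball x 1 \<inter> lambert_dom. cmod (?f r y) \<le> cmod (h r)"
      using eventually_norm_mult_power_less[of "1/2" R]
    proof (rule eventually_mono, simp, intro ballI)
      fix r y assume r: "R * norm q ^ r < 1/2" and y: "y \<in> ball x 1 \<inter> lambert_dom"
      have "norm y \<le> R"
        using y norm_triangle_sub[of y x] by (auto simp: R_def dist_norm norm_minus_commute)
      then have 1: "norm (y * q ^ r) \<le> R * norm q ^ r"
        by (simp add: norm_mult norm_power mult_right_mono)
      then have 2: "norm (1 - y * q ^ r) \<ge> 1/2"
        using r norm_triangle_ineq2[of 1 "y * q ^ r"] by simp
      have "norm (?f r y) \<le> (R * norm q ^ r) / (1/2)"
        unfolding norm_divide by (rule frac_le) (use 1 2 R in auto)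
      also have "\<dots> = norm (h r)"
        using R by (simp add: h_def norm_mult norm_power)
      finally show "norm (?f r y) \<le> norm (h r)" .
    qed
    ultimately show "\<exists>d h. 0 < d \<and> summable h \<and> range h \<subseteq> \<real>\<^sub>\<ge>\<^sub>0 \<and>
        (\<forall>\<^sub>F r in sequentially. \<forall>y\<in>ball x d \<inter> lambert_dom. cmod (?f r y) \<le> cmod (h r))"
      by (intro exI[of _ 1] exI[of _ h]) simp
  qed
  then obtain g g' where g: "\<And>x. x \<in> lambert_dom \<Longrightarrow> (\<lambda>r. ?f r x) sums g x"
      "\<And>x. x \<in> lambert_dom \<Longrightarrow> (\<lambda>r. ?f' r x) sums g' x"
      "\<And>x. x \<in> lambert_dom \<Longrightarrow> (g has_field_derivative g' x) (at x)"
    by blast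
  have g_eq: "lambert x = g x" "lambert' x = g' x" if "x \<in> lambert_dom" for x
    using g(1,2)[OF that] by (simp_all add: lambert_def lambert'_def sums_iff)
  show "(\<lambda>r. ?f r x) sums lambert x" "(\<lambda>r. ?f' r x) sums lambert' x"
    using g assms by (simp_all add: g_eq)
  show "(lambert has_field_derivative lambert' x) (at x)"
    using has_field_derivative_transform_within_open[OF g(3)[OF assms] open_lambert_dom assms, of lambert]
      g_eq assms by simp
qed

text \<open>On its open domain \<open>lambert'\<close> is the derivative of the holomorphic function
  \<open>lambert\<close>, hence holomorphic itself.\<close>

lemma lambert'_field_differentiable [intro]:
  assumes "x \<in> lambert_dom"
  shows "lambert' field_differentiable (at x)"
proof -
  have "lambert holomorphic_on lambert_dom"
    using lambert_sums_and_deriv(3) open_lambert_dom holomorphic_on_open by blast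
  then have "deriv lambert holomorphic_on lambert_dom"
    by (intro holomorphic_deriv) auto
  then have "lambert' holomorphic_on lambert_dom"
    using lambert_sums_and_deriv(3) by (subst holomorphic_cong[OF refl]) (auto intro!: DERIV_imp_deriv[symmetric])
  then show ?thesis
    using assms holomorphic_on_imp_differentiable_at open_lambert_dom by blast
qed

lemma lambert_dom_mult_q: "x \<in> lambert_dom \<Longrightarrow> q * x \<in> lambert_dom"
  unfolding lambert_dom_def
proof safe
  fix r assume "\<forall>r. x * q ^ r \<noteq> 1" "q * x * q ^ r = 1"
  then show False by (metis mult.assoc mult.commute power_Suc)
qed

lemma lambert_rec: "x \<in> lambert_dom \<Longrightarrow> lambert x = x / (1 - x) + lambert (q * x)"
  using suminf_split_head[OF sums_summable[OF lambert_sums_and_deriv(1)], of x]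
  by (simp add: lambert_def mult_ac)

lemma lambert'_rec:
  assumes "x \<in> lambert_dom"
  shows "lambert' x = 1 / (1 - x) ^ 2 + q * lambert' (q * x)"
proof -
  have "q * lambert' (q * x) = (\<Sum>r. q * (q ^ r / (1 - q * x * q ^ r) ^ 2))"
    unfolding lambert'_def
    by (rule suminf_mult[symmetric]) (use lambert_sums_and_deriv(2)[OF lambert_dom_mult_q[OF assms]] in \<open>simp add: sums_iff\<close>)
  then show ?thesis
    using suminf_split_head[OF sums_summable[OF lambert_sums_and_deriv(2)[OF assms]]]
    by (simp add: lambert'_def mult_ac)
qed

lemma power_Suc_neq_1: "q ^ Suc n \<noteq> 1"
proof
  assume "q ^ Suc n = 1"
  then have "norm q ^ Suc n = 1" by (metis norm_one norm_power)
  then show False using norm_q_less power_Suc_less_one[of "norm q" n] by simp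
qed

lemma q_in_lambert_dom [simp]: "q \<in> lambert_dom"
  using power_Suc_neq_1 by (simp add: lambert_dom_def)

section \<open>The group of integer powers of q as exceptional set\<close>

lemma one_in_powers [simp]: "1 \<in> powers"
  unfolding powers_def by (rule range_eqI[of _ _ 0]) simp

lemma zero_notin_powers [simp]: "0 \<notin> powers"
  by (auto simp: powers_def)

lemma powers_mult: "x \<in> powers \<Longrightarrow> y \<in> powers \<Longrightarrow> x * y \<in> powers"
  unfolding powers_def by (auto simp flip: power_int_add)

lemma powers_inverse: "x \<in> powers \<Longrightarrow> inverse x \<in> powers"
  unfolding powers_def by (auto simp flip: power_int_minus)

lemma powers_mult_iff [simp]: "x \<in> powers \<Longrightarrow> x * y \<in> powers \<longleftrightarrow> y \<in> powers"
  using powers_mult[of x y] powers_mult[OF powers_inverse, of x "x * y"]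
  by (cases "x = 0") (auto simp flip: mult.assoc)

lemma powers_inverse_iff [simp]: "inverse x \<in> powers \<longleftrightarrow> x \<in> powers"
  using powers_inverse[of x] powers_inverse[of "inverse x"] by auto

lemma q_in_powers [simp]: "q \<in> powers"
  unfolding powers_def by (rule range_eqI[of _ _ 1]) simp

text \<open>The series at \<open>z\<close> excludes the powers of \<open>q\<close> with exponent at
  most 0, the series at \<open>q / z\<close> those with exponent at least 1; together these are all
  of \<open>powers\<close>.\<close>

lemma notin_powers_iff:
  assumes "z \<noteq> 0"
  shows "z \<notin> powers \<longleftrightarrow> z \<in> lambert_dom \<and> q / z \<in> lambert_dom"
proof -
  have "z \<in> powers \<longleftrightarrow> (\<exists>n. z * q ^ n = 1) \<or> (\<exists>n. q / z * q ^ n = 1)"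
  proof
    assume "z \<in> powers"
    then obtain n where n: "z = q powi n" by (auto simp: powers_def)
    show "(\<exists>n. z * q ^ n = 1) \<or> (\<exists>n. q / z * q ^ n = 1)"
    proof (cases n rule: int_cases)
      case (nonneg m)
      show ?thesis
      proof (cases m)
        case 0
        then have "z * q ^ 0 = 1" by (simp add: n nonneg)
        then show ?thesis by blast
      next
        case (Suc k)
        then have "z = q * q ^ k"
          by (metis n nonneg power_Suc power_int_of_nat)
        then have "q / z * q ^ k = 1" by simp
        then show ?thesis by blast
      qed
    next
      case (neg k)
      have "z * q ^ Suc k = 1"
        unfolding n neg power_int_minus power_int_of_nat by (simp del: power_Suc)
      then show ?thesis by blast
    qed
  next
    assume "(\<exists>n. z * q ^ n = 1) \<or> (\<exists>n. q / z * q ^ n = 1)"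
    then show "z \<in> powers"
    proof (elim disjE exE)
      fix n assume "z * q ^ n = 1"
      then have "z = q powi (- int n)"
        using assms by (simp add: power_int_minus field_simps)
      then show ?thesis unfolding powers_def by blast
    next
      fix n assume "q / z * q ^ n = 1"
      then have "z = q powi (int (Suc n))"
        using assms by (simp only: power_int_of_nat) (simp add: field_simps)
      then show ?thesis unfolding powers_def by blast
    qed
  qed
  then show ?thesis by (auto simp: lambert_dom_def)
qed

lemma eventually_in_lambert_dom:
  assumes "isCont h z" "h z \<in> lambert_dom"
  shows "eventually (\<lambda>w. h w \<in> lambert_dom) (nhds z)"
  using topological_tendstoD[OF _ open_lambert_dom assms(2), of h "at z"] assms
  by (simp add: continuous_within eventually_nhds_conv_at)

text \<open>\<open>powers\<close> is discrete away from 0. For \<open>w\<close> near 1, both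
  \<open>q * w\<close> and \<open>q / w\<close> stay near \<open>q\<close>, inside the open
  \<open>lambert_dom\<close>, so the only condition that can fail is the one for
  \<open>r = 0\<close>, that is, \<open>w \<noteq> 1\<close>. Multiplication by
  \<open>inverse z\<close> carries any other power \<open>z\<close> to 1.\<close>

lemma eventually_notin_powers:
  assumes "z \<noteq> 0"
  shows "eventually (\<lambda>w. w \<notin> powers) (at z)"
proof -
  have nz: "eventually (\<lambda>w. w \<noteq> 0) (nhds z)" if "z \<noteq> 0" for z :: complex
    using t1_space_nhds[OF that] .
  have 1: "eventually (\<lambda>w. w \<notin> powers) (at (1::complex))"
  proof -
    have "eventually (\<lambda>w. q * w \<in> lambert_dom) (nhds 1)" "eventually (\<lambda>w. q / w \<in> lambert_dom) (nhds 1)"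
      by (intro eventually_in_lambert_dom continuous_intros; simp)+
    moreover note nz[of 1, OF one_neq_zero]
    ultimately have "eventually (\<lambda>w. w \<noteq> 1 \<longrightarrow> w \<notin> powers) (nhds 1)"
    proof eventually_elim
      case (elim w)
      have "w \<in> lambert_dom" if "w \<noteq> 1"
        unfolding lambert_dom_def
      proof safe
        fix r assume "w * q ^ r = 1"
        with elim(1) that show False
          by (cases r) (auto simp: lambert_dom_def mult_ac)
      qed
      with elim show ?case by (auto simp: notin_powers_iff)
    qed
    then show ?thesis by (simp add: eventually_at_filter)
  qed
  show ?thesis
  proof (cases "z \<in> powers")
    case False
    then have "z \<in> lambert_dom" "q / z \<in> lambert_dom"
      using assms by (auto simp: notin_powers_iff)
    then have "eventually (\<lambda>w. w \<in> lambert_dom) (nhds z)" "eventually (\<lambda>w. q / w \<in> lambert_dom) (nhds z)"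
      by (intro eventually_in_lambert_dom continuous_intros; simp add: assms)+
    with nz[OF assms] have "eventually (\<lambda>w. w \<notin> powers) (nhds z)"
      by eventually_elim (auto simp: notin_powers_iff)
    then show ?thesis by (simp add: eventually_nhds_conv_at)
  next
    case True
    have "filterlim (\<lambda>w. inverse z * w) (at 1) (at z)"
      unfolding filterlim_at using assms
      by (auto simp: eventually_at_filter field_simps intro!: tendsto_eq_intros)
    then have "eventually (\<lambda>w. inverse z * w \<notin> powers) (at z)"
      using 1 unfolding filterlim_iff by blast
    then show ?thesis using True by simp
  qed
qed


section \<open>Multiplicative zeta and P functions and their functional equations\<close>

text \<open>
  With \<open>z = exp u\<close>, these are \<open>-\<zeta>(u)\<close> up to a linear term and \<open>P(u)\<close> up to a constant; the sums
  over \<open>r \<ge> 1\<close> in \<open>1 / z\<close> are reindexed as Lambert series at \<open>q / z\<close>.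
\<close>

definition eis1 :: "complex \<Rightarrow> complex" where
  "eis1 z = 1 / 2 + lambert z - lambert (q / z)"

definition eis2 :: "complex \<Rightarrow> complex" where
  "eis2 z = z * lambert' z + q / z * lambert' (q / z)"

text \<open>Splitting off the terms \<open>r = 0\<close> at \<open>z\<close> and at
  \<open>1 / z\<close> leaves two rational functions: they add up to -1 in the first case and agree,
  after weighting by \<open>z\<close> and \<open>1 / z\<close>, in the second. Eliminating the
  series at \<open>1 / z\<close> makes the four functional equations below plain rewriting.\<close>

lemma
  assumes "z \<notin> powers" "z \<noteq> 0"
  shows lambert_reflect: "lambert (1 / z) = lambert (q * z) + lambert (q / z) - lambert z - 1"
    and lambert'_reflect:
      "lambert' (1 / z) / z = z * lambert' z + q / z * lambert' (q / z) - q * z * lambert' (q * z)"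
proof -
  have dom: "z \<in> lambert_dom" "1 / z \<in> lambert_dom" "z \<noteq> 1"
    using assms notin_powers_iff[of z] notin_powers_iff[of "inverse z"] by (auto simp: divide_inverse)
  have "z / (1 - z) + 1 / z / (1 - 1 / z) = -1"
    using assms dom(3) by (simp add: divide_simps) (simp add: algebra_simps)
  moreover have "lambert z = z / (1 - z) + lambert (q * z)"
    "lambert (1 / z) = 1 / z / (1 - 1 / z) + lambert (q / z)"
    using lambert_rec[OF dom(1)] lambert_rec[OF dom(2)] by simp_all
  ultimately show "lambert (1 / z) = lambert (q * z) + lambert (q / z) - lambert z - 1"
    by (simp add: algebra_simps)
  have "z * (1 / (1 - z) ^ 2) = 1 / z * (1 / (1 - 1 / z) ^ 2)"
    using assms dom(3) by (simp add: divide_simps) (simp add: algebra_simps power2_eq_square)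
  moreover have "lambert' z = 1 / (1 - z) ^ 2 + q * lambert' (q * z)"
    "lambert' (1 / z) = 1 / (1 - 1 / z) ^ 2 + q * lambert' (q / z)"
    using lambert'_rec[OF dom(1)] lambert'_rec[OF dom(2)] by simp_all
  ultimately show
    "lambert' (1 / z) / z = z * lambert' z + q / z * lambert' (q / z) - q * z * lambert' (q * z)"
    by (simp add: ring_distribs add_divide_distrib)
qed

lemma eis1_mult_q:
  assumes "z \<notin> powers" "z \<noteq> 0"
  shows "eis1 (q * z) = eis1 z + 1"
  by (simp add: eis1_def lambert_reflect[OF assms])

lemma eis2_mult_q:
  assumes "z \<notin> powers" "z \<noteq> 0"
  shows "eis2 (q * z) = eis2 z"
  by (simp add: eis2_def lambert'_reflect[OF assms])

text \<open>The constant 1/2 in \<open>eis1\<close> is what makes it odd: it absorbs half of the -1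
  in \<open>lambert_reflect\<close>.\<close>

lemma eis1_inverse:
  assumes "z \<notin> powers" "z \<noteq> 0"
  shows "eis1 (inverse z) = - eis1 z"
  unfolding inverse_eq_divide by (simp add: eis1_def lambert_reflect[OF assms])

lemma eis2_inverse:
  assumes "z \<notin> powers" "z \<noteq> 0"
  shows "eis2 (inverse z) = eis2 z"
  unfolding inverse_eq_divide by (simp add: eis2_def lambert'_reflect[OF assms])

text \<open>With \<open>z = exp u\<close> this is the relation \<zeta>' = -P, up to the normalising
  constants.\<close>

lemma eis1_has_field_derivative:
  assumes "z \<notin> powers" "z \<noteq> 0"
  shows "(eis1 has_field_derivative eis2 z / z) (at z)"
proof -
  have "z \<in> lambert_dom" "q / z \<in> lambert_dom"
    using assms notin_powers_iff by auto
  note [derivative_intros] = lambert_sums_and_deriv(3)[THEN DERIV_chain2]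
  show ?thesis
    unfolding eis1_def
    by (rule derivative_eq_intros refl \<open>z \<in> lambert_dom\<close> \<open>q / z \<in> lambert_dom\<close> assms)+
      (use assms in \<open>simp add: eis2_def field_simps power2_eq_square\<close>)
qed

lemma eis2_field_differentiable:
  assumes "z \<notin> powers" "z \<noteq> 0"
  shows "eis2 field_differentiable (at z)"
proof -
  have "z \<in> lambert_dom" "q / z \<in> lambert_dom"
    using assms notin_powers_iff by auto
  then have "lambert' field_differentiable (at z)" "lambert' field_differentiable (at (q / z))"
    by auto
  moreover have "(\<lambda>z. q / z) field_differentiable (at z)"
    using assms by (intro derivative_intros) auto
  ultimately have "lambert' \<circ> (\<lambda>z. q / z) field_differentiable (at z)"
    by (intro field_differentiable_compose) 
  then show ?thesis
    unfolding eis2_def o_def using assms \<open>lambert' field_differentiable (at z)\<close>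
    by (intro derivative_intros) auto
qed

section \<open>The difference of the two sides: symmetries and limits\<close>

definition defect :: "complex \<Rightarrow> complex \<Rightarrow> complex" where
  "defect b c = (eis1 b + eis1 c - eis1 (b * c)) ^ 2
     - (1 / 4 + eis2 b + eis2 c + eis2 (b * c) - 6 * (q * lambert' q))"

text \<open>The increments 1 of \<open>eis1 b\<close> and \<open>eis1 (b * c)\<close>
  cancel.\<close>

lemma defect_mult_q:
  assumes "b \<notin> powers" "b \<noteq> 0" "b * c \<notin> powers" "c \<noteq> 0"
  shows "defect (q * b) c = defect b c"
  using assms
  by (simp add: defect_def eis1_mult_q eis2_mult_q mult.assoc) (simp add: power2_eq_square algebra_simps)

lemma defect_mult_powers:
  assumes "b \<notin> powers" "b \<noteq> 0" "b * c \<notin> powers" "c \<noteq> 0" "w \<in> powers"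
  shows "defect (w * b) c = defect b c"
proof -
  obtain n where n: "w = q powi n" using assms by (auto simp: powers_def)
  have in_powers: "q powi m \<in> powers" for m by (simp add: powers_def)
  have step: "defect (q powi (m + 1) * b) c = defect (q powi m * b) c" for m
    using defect_mult_q[of "q powi m * b" c] assms in_powers[of m]
    by (simp add: power_int_add mult.assoc mult.left_commute[of _ q])
  have "defect (q powi n * b) c = defect b c"
  proof (induction n rule: int_induct[where k = 0])
    \<comment> \<open>The downward induction step is \<open>step\<close> at \<open>i - 1\<close>,
      read from right to left.\<close>
    case (step2 i)
    then show ?case using step[of "i - 1"] by simp
  qed (simp_all add: step)
  then show ?thesis by (simp add: n)
qed

text \<open>In terms of \<^term>\<open>a = inverse (b * c)\<close> the defect is symmetric in \<^term>\<open>a\<close>, \<^term>\<open>b\<close>, \<^term>\<open>c\<close>.\<close>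

lemma defect_inverse:
  assumes "b \<notin> powers" "b \<noteq> 0" "b * c \<notin> powers" "c \<noteq> 0"
  shows "defect (inverse (b * c)) c = defect b c"
proof -
  have "inverse (b * c) * c = inverse b" using assms by (simp add: field_simps)
  then show ?thesis
    using assms eis1_inverse[of "b * c"] eis2_inverse[of "b * c"] eis1_inverse[of b] eis2_inverse[of b]
    by (simp add: defect_def algebra_simps del: inverse_mult_distrib)
qed

text \<open>Near \<open>b = 1\<close> the base of the square is \<open>h + G b\<close>, with a
  simple pole in \<open>h\<close> and \<open>G 1 = 0\<close>. The terms from \<open>h ^ 2\<close>
  cancel against 1/4 and the double pole of \<open>eis2 b\<close>, while the cross term
  \<open>2 * h * G b\<close> tends to -2 times the derivative of \<open>G\<close> at 1.\<close>

lemma defect_tendsto_0: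
  assumes "c \<notin> powers" "c \<noteq> 0"
  shows "((\<lambda>b. defect b c) \<longlongrightarrow> 0) (at 1)"
proof -
  \<comment> \<open>\<open>G\<close> and \<open>M\<close> are the parts of the base and of
    \<open>eis2 b\<close> that stay regular at 1, once the term \<open>r = 0\<close> of the series
    at \<open>b\<close> is removed.\<close>
  define G where "G = (\<lambda>b. lambert (q * b) - lambert (q / b) + eis1 c - eis1 (b * c))"
  define M where "M = (\<lambda>b. q * b * lambert' (q * b) + q / b * lambert' (q / b))"
  have cont: "isCont lambert' q"
    using lambert'_field_differentiable[OF q_in_lambert_dom] field_differentiable_imp_continuous_at by blast
  have G1: "G 1 = 0" by (simp add: G_def)
  note [derivative_intros] = lambert_sums_and_deriv(3)[THEN DERIV_chain2]
    eis1_has_field_derivative[THEN DERIV_chain2]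
  have G': "(G has_field_derivative 2 * (q * lambert' q) - eis2 c) (at 1)"
    unfolding G_def
    by (rule derivative_eq_intros refl | simp add: assms)+
  then have quot: "((\<lambda>b. G b / (b - 1)) \<longlongrightarrow> 2 * (q * lambert' q) - eis2 c) (at 1)"
    by (simp add: has_field_derivative_iff G1)
  have "G \<midarrow>1\<rightarrow> 0"
    using DERIV_isCont[OF G'] by (simp add: isCont_def G1)
  moreover have "M \<midarrow>1\<rightarrow> 2 * (q * lambert' q)"
  proof -
    have "isCont M 1"
    proof -
      have "isCont (\<lambda>b. lambert' (q * b)) 1" "isCont (\<lambda>b. lambert' (q / b)) 1"
        by (rule isCont_o2[where g = lambert']; simp add: cont)+
      then show ?thesis unfolding M_def by (intro continuous_intros) auto
    qed
    then show ?thesis by (simp add: isCont_def M_def)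
  qed
  moreover have "(\<lambda>b. eis2 (b * c)) \<midarrow>1\<rightarrow> eis2 c"
  proof -
    have "isCont eis2 (1 * c)"
      using field_differentiable_imp_continuous_at[OF eis2_field_differentiable[OF assms]] by simp
    then have "isCont (\<lambda>b. eis2 (b * c)) 1"
      by (intro isCont_o2[where f = "\<lambda>b. b * c" and g = eis2] continuous_intros)
    then show ?thesis by (simp add: isCont_def)
  qed
  \<comment> \<open>With S = \<open>q * lambert' q\<close> and P = \<open>eis2 c\<close> the limit
    is -2(2S - P) - 2S - 2P + 6S = 0, which explains the coefficient 6.\<close>
  ultimately have "((\<lambda>b. - (1 + b) * (G b / (b - 1)) + G b ^ 2 - M b - eis2 c - eis2 (b * c) + 6 * (q * lambert' q))
      \<longlongrightarrow> - (1 + 1) * (2 * (q * lambert' q) - eis2 c) + 0 ^ 2 - 2 * (q * lambert' q) - eis2 c - eis2 c + 6 * (q * lambert' q)) (at 1)"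
    by (intro tendsto_intros quot)
  then have "((\<lambda>b. - (1 + b) * (G b / (b - 1)) + G b ^ 2 - M b - eis2 c - eis2 (b * c) + 6 * (q * lambert' q))
      \<longlongrightarrow> 0) (at 1)" by simp
  moreover have "eventually (\<lambda>b. - (1 + b) * (G b / (b - 1)) + G b ^ 2 - M b - eis2 c - eis2 (b * c) + 6 * (q * lambert' q)
      = defect b c) (at 1)"
    using eventually_notin_powers[OF one_neq_zero] eventually_neq_at_within[of 0]
  proof eventually_elim
    case (elim b)
    then have b: "b \<in> lambert_dom" "b \<noteq> 1" using notin_powers_iff[of b] by auto
    \<comment> \<open>The constant 1/2 of \<open>eis1\<close> combined with the term
      \<open>b / (1 - b)\<close> split off by \<open>lambert_rec\<close>.\<close>
    define h where "h = (1 + b) / (2 * (1 - b))"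
    have h: "eis1 b + eis1 c - eis1 (b * c) = h + G b"
    proof -
      have "h = 1 / 2 + b / (1 - b)"
        using b by (simp add: h_def divide_simps)
      then show ?thesis by (simp add: eis1_def G_def lambert_rec[OF b(1)] mult.commute)
    qed
    txt \<open>The double poles of both sides cancel exactly, not only to leading order.\<close>
    have h2: "h ^ 2 = 1 / 4 + b / (1 - b) ^ 2"
      using b by (simp add: h_def power2_eq_square divide_simps) (simp add: algebra_simps)
    have P: "eis2 b = b / (1 - b) ^ 2 + M b"
      by (simp add: eis2_def M_def lambert'_rec[OF b(1)] algebra_simps)
    have "2 * h * G b = - (1 + b) * (G b / (b - 1))"
      using b by (simp add: h_def field_simps)
    then show ?case
      unfolding defect_def h P power2_sum h2 by (simp add: algebra_simps)
  qed
  ultimately show ?thesis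
    by (rule Lim_transform_eventually)
qed

text \<open>Multiplication by \<open>inverse p\<close> moves \<open>p\<close> to 1. Invariance
  applies only where \<open>b\<close> and \<open>b * c\<close> avoid \<open>powers\<close>, which
  holds on a punctured neighbourhood of \<open>p\<close>.\<close>

lemma defect_tendsto_0_powers:
  assumes "p \<in> powers" "c \<notin> powers" "c \<noteq> 0"
  shows "((\<lambda>b. defect b c) \<longlongrightarrow> 0) (at p)"
proof -
  have p: "p \<noteq> 0" using assms by auto
  have lim: "filterlim (\<lambda>b. inverse p * b) (at 1) (at p)"
    unfolding filterlim_at using p
    by (auto simp: eventually_at_filter field_simps intro!: tendsto_eq_intros)
  have "filterlim (\<lambda>b. b * c) (at (p * c)) (at p)"
    unfolding filterlim_at using assms
    by (auto simp: eventually_at_filter field_simps intro!: tendsto_eq_intros)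
  then have "eventually (\<lambda>b. b * c \<notin> powers) (at p)"
    using eventually_notin_powers[of "p * c"] p assms unfolding filterlim_iff by auto
  with eventually_notin_powers[OF p] eventually_neq_at_within[of 0]
  have "eventually (\<lambda>b. defect (inverse p * b) c = defect b c) (at p)"
    by eventually_elim (use assms in \<open>simp add: defect_mult_powers\<close>)
  moreover have "((\<lambda>b. defect (inverse p * b) c) \<longlongrightarrow> 0) (at p)"
    using filterlim_compose[OF defect_tendsto_0[OF assms(2,3)] lim] .
  ultimately show ?thesis
    by (rule Lim_transform_eventually[rotated])
qed

text \<open>The substitution of \<open>inverse (b * c)\<close> for \<open>b\<close> moves the
  singularity to \<open>inverse (p * c)\<close>, itself a power of \<open>q\<close>, and so reduces
  to the previous case.\<close>

lemma defect_tendsto_0_mult_powers: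
  assumes "p * c \<in> powers" "c \<notin> powers" "c \<noteq> 0"
  shows "((\<lambda>b. defect b c) \<longlongrightarrow> 0) (at p)"
proof -
  have p: "p \<noteq> 0" using assms by auto
  have lim: "filterlim (\<lambda>b. inverse (b * c)) (at (inverse (p * c))) (at p)"
    unfolding filterlim_at using p assms
    by (auto simp: eventually_at_filter field_simps intro!: tendsto_eq_intros)
  have "eventually (\<lambda>b. inverse (b * c) \<notin> powers) (at p)"
    using lim eventually_notin_powers[of "inverse (p * c)"] p assms unfolding filterlim_iff by auto
  with eventually_notin_powers[OF p] eventually_neq_at_within[of 0]
  have "eventually (\<lambda>b. defect (inverse (b * c)) c = defect b c) (at p)"
    by eventually_elim (use assms in \<open>simp add: defect_inverse del: inverse_mult_distrib\<close>)
  moreover have "((\<lambda>b. defect (inverse (b * c)) c) \<longlongrightarrow> 0) (at p)"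
    by (rule filterlim_compose[OF defect_tendsto_0_powers lim])
      (use assms in \<open>simp_all del: inverse_mult_distrib\<close>)
  ultimately show ?thesis
    by (rule Lim_transform_eventually[rotated])
qed

section \<open>Holomorphic extension and Liouville's theorem\<close>

lemma defect_field_differentiable:
  assumes "b \<notin> powers" "b \<noteq> 0" "b * c \<notin> powers" "c \<noteq> 0"
  shows "(\<lambda>b. defect b c) field_differentiable (at b)"
proof -
  have e1: "eis1 field_differentiable (at z)" if "z \<notin> powers" "z \<noteq> 0" for z
    using eis1_has_field_derivative[OF that] by (auto simp: field_differentiable_def)
  have m: "(\<lambda>b. b * c) field_differentiable (at b)"
    by (intro derivative_intros)
  have "eis1 \<circ> (\<lambda>b. b * c) field_differentiable (at b)" "eis2 \<circ> (\<lambda>b. b * c) field_differentiable (at b)"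
    by (rule field_differentiable_compose[OF m]; use assms in \<open>simp add: e1 eis2_field_differentiable\<close>)+
  then show ?thesis
    unfolding defect_def o_def using assms
    by (intro derivative_intros e1 eis2_field_differentiable) auto
qed

text \<open>Multiplication by a power of \<open>q\<close> shifts \<open>t\<close>, the logarithm of
  \<open>norm z\<close> to base \<open>norm q\<close>, by an integer; subtracting its floor brings
  it into [0, 1].\<close>

lemma powers_annulus:
  assumes "z \<noteq> 0"
  obtains w where "w \<in> powers" "norm q \<le> norm (w * z)" "norm (w * z) \<le> 1"
proof -
  define t where "t = ln (norm z) / ln (norm q)"
  define n where "n = \<lfloor>t\<rfloor>"
  have lq: "ln (norm q) < 0" using norm_q_less by simp
  have ln_eq: "ln (norm (q powi (-n) * z)) = (t - n) * ln (norm q)"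
    using assms lq
    by (simp add: norm_mult norm_power_int ln_mult ln_powr t_def algebra_simps flip: powr_real_of_int')
  have "0 \<le> t - n" "t - n \<le> 1" unfolding n_def by linarith+
  then have "ln (norm (q powi (-n) * z)) \<le> 0" "ln (norm (q powi (-n) * z)) \<ge> ln (norm q)"
    unfolding ln_eq using lq by (auto simp: mult_le_0_iff)
  then have "norm (q powi (-n) * z) \<le> 1" "norm q \<le> norm (q powi (-n) * z)"
    using assms by auto
  then show ?thesis
    by (intro that[of "q powi (-n)"]) (auto simp: powers_def)
qed

lemma defect_eq_0:
  assumes b: "b \<notin> powers" "b \<noteq> 0" and bc: "b * c \<notin> powers" and c: "c \<notin> powers" "c \<noteq> 0"
  shows "defect b c = 0"
proof -
  \<comment> \<open>The value 0 at the exceptional points is the limit found above, so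
    \<open>g\<close> is continuous there. At 0 its value is arbitrary; the argument stays in the
    punctured plane.\<close>
  define g where "g = (\<lambda>z. if z \<in> powers \<or> z * c \<in> powers then 0 else defect z c)"
  have holo: "g field_differentiable (at p)" if p: "p \<noteq> 0" for p
  proof -
    have "filterlim (\<lambda>b. b * c) (at (p * c)) (at p)"
      unfolding filterlim_at using p c
      by (auto simp: eventually_at_filter field_simps intro!: tendsto_eq_intros)
    then have "eventually (\<lambda>z. z * c \<notin> powers) (at p)"
      using eventually_notin_powers[of "p * c"] p c unfolding filterlim_iff by auto
    with eventually_notin_powers[OF p] eventually_neq_at_within[of 0]
    have ev: "eventually (\<lambda>z. z \<notin> powers \<and> z \<noteq> 0 \<and> z * c \<notin> powers) (at p)"
      by eventually_elim auto
    then obtain S where S: "open S" "p \<in> S"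
      "\<And>z. z \<in> S \<Longrightarrow> z \<noteq> p \<Longrightarrow> z \<notin> powers \<and> z \<noteq> 0 \<and> z * c \<notin> powers"
      unfolding eventually_at_topological by blast
    have tends: "g \<midarrow>p\<rightarrow> g p"
    proof -
      have "((\<lambda>z. defect z c) \<longlongrightarrow> g p) (at p)"
      proof (cases "p \<in> powers \<or> p * c \<in> powers")
        case True
        then show ?thesis
          using defect_tendsto_0_powers defect_tendsto_0_mult_powers c by (auto simp: g_def)
      next
        case False
        then have "isCont (\<lambda>z. defect z c) p"
          using defect_field_differentiable[of p c] p c field_differentiable_imp_continuous_at by blast
        then show ?thesis using False by (simp add: isCont_def g_def)
      qed
      moreover have "eventually (\<lambda>z. defect z c = g z) (at p)"
        using ev by eventually_elim (auto simp: g_def)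
      ultimately show ?thesis by (rule Lim_transform_eventually)
    qed
    have "(\<lambda>z. defect z c) holomorphic_on S - {p}"
      unfolding holomorphic_on_def
      by (rule ballI, rule field_differentiable_at_within, rule defect_field_differentiable)
        (use S(3) c in auto)
    then have "g holomorphic_on S - {p}"
      by (rule holomorphic_transform) (use S(3) in \<open>auto simp: g_def\<close>)
    \<comment> \<open>Within \<open>S\<close> the point \<open>p\<close> is the only possible
      singularity, and it is removable by continuity.\<close>
    then have "g holomorphic_on S"
      by (rule no_isolated_singularity'[rotated])
        (use S(1) tends in \<open>auto intro: tendsto_within_subset\<close>)
    then show ?thesis
      using S(1,2) by (rule holomorphic_on_imp_differentiable_at)
  qed
  have inv: "g (w * z) = g z" if "z \<noteq> 0" "w \<in> powers" for z w
    using that c by (auto simp: g_def mult.assoc defect_mult_powers)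
  define K where "K = {z :: complex. norm q \<le> norm z \<and> norm z \<le> 1}"
  have "K = cball 0 1 - ball 0 (norm q)" by (auto simp: K_def)
  then have "compact K" by (simp add: compact_diff)
  moreover have "continuous_on K g"
    by (intro continuous_at_imp_continuous_on ballI field_differentiable_imp_continuous_at holo)
      (auto simp: K_def)
  ultimately have bdd: "bounded (g ` K)"
    using compact_continuous_image compact_imp_bounded by blast
  have "range (g \<circ> exp) \<subseteq> g ` K"
  proof safe
    fix u
    obtain w where "w \<in> powers" "norm q \<le> norm (w * exp u)" "norm (w * exp u) \<le> 1"
      using powers_annulus[of "exp u"] by auto
    then show "(g \<circ> exp) u \<in> g ` K"
      using inv[of "exp u" w] by (intro image_eqI[of _ _ "w * exp u"]) (auto simp: K_def)
  qed
  with bdd have "bounded (range (g \<circ> exp))" by (rule bounded_subset)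
  moreover have "g holomorphic_on - {0}"
    unfolding holomorphic_on_def
    by (rule ballI, rule field_differentiable_at_within, rule holo) simp
  then have "g \<circ> exp holomorphic_on UNIV"
    by (rule holomorphic_on_compose_gen[OF holomorphic_on_exp]) auto
  ultimately have "g \<circ> exp constant_on UNIV"
    by (intro Liouville_theorem)
  \<comment> \<open>The constant is read off at \<open>exp 0 = 1\<close>, a power of
    \<open>q\<close>, where \<open>g\<close> is 0 by definition.\<close>
  then have "g (exp (Ln b)) = g (exp 0)"
    unfolding constant_on_def by (metis UNIV_I o_apply)
  then show ?thesis
    using b bc by (simp add: g_def exp_Ln)
qed

section \<open>Return to the explicit series\<close>

lemma lambert_split_sums:
  assumes "z \<notin> powers" "z \<noteq> 0"
  shows "(\<lambda>r. z * q ^ r / (1 - z * q ^ r)) sums lambert z"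
    and "(\<lambda>r. inverse z * q ^ Suc r / (1 - inverse z * q ^ Suc r)) sums lambert (q / z)"
    and "(\<lambda>r. z * q ^ r / (1 - z * q ^ r) ^ 2) sums (z * lambert' z)"
    and "(\<lambda>r. inverse z * q ^ Suc r / (1 - inverse z * q ^ Suc r) ^ 2) sums (q / z * lambert' (q / z))"
proof -
  have dom: "z \<in> lambert_dom" "q / z \<in> lambert_dom"
    using assms notin_powers_iff by auto
  have shift: "inverse z * q ^ Suc r = q / z * q ^ r" for r
    by (simp add: divide_inverse)
  show "(\<lambda>r. z * q ^ r / (1 - z * q ^ r)) sums lambert z"
    "(\<lambda>r. inverse z * q ^ Suc r / (1 - inverse z * q ^ Suc r)) sums lambert (q / z)"
    unfolding shift using lambert_sums_and_deriv(1) dom by blast+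
  show "(\<lambda>r. z * q ^ r / (1 - z * q ^ r) ^ 2) sums (z * lambert' z)"
    "(\<lambda>r. inverse z * q ^ Suc r / (1 - inverse z * q ^ Suc r) ^ 2) sums (q / z * lambert' (q / z))"
    unfolding shift
    using sums_mult[OF lambert_sums_and_deriv(2)[OF dom(1)], of z]
      sums_mult[OF lambert_sums_and_deriv(2)[OF dom(2)], of "q / z"] by simp_all
qed

end

theorem proposition3:
  fixes q b c :: complex
  assumes "0 < norm q" and "norm q < 1"
    and "b \<noteq> 0" and "c \<noteq> 0"
    and "\<And>n::int. b \<noteq> q powi n"
    and "\<And>n::int. c \<noteq> q powi n"
    and "\<And>n::int. b * c \<noteq> q powi n"
  shows
    "(1 / 2
      + (\<Sum>r. b * q ^ r / (1 - b * q ^ r))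
      - (\<Sum>r. inverse b * q ^ Suc r / (1 - inverse b * q ^ Suc r))
      + (\<Sum>r. c * q ^ r / (1 - c * q ^ r))
      - (\<Sum>r. inverse c * q ^ Suc r / (1 - inverse c * q ^ Suc r))
      - (\<Sum>r. b * c * q ^ r / (1 - b * c * q ^ r))
      + (\<Sum>r. inverse b * inverse c * q ^ Suc r / (1 - inverse b * inverse c * q ^ Suc r))) ^ 2
     = 1 / 4
      + (\<Sum>r. b * q ^ r / (1 - b * q ^ r) ^ 2
            + c * q ^ r / (1 - c * q ^ r) ^ 2
            + b * c * q ^ r / (1 - b * c * q ^ r) ^ 2)
      + (\<Sum>r. inverse b * q ^ Suc r / (1 - inverse b * q ^ Suc r) ^ 2
            + inverse c * q ^ Suc r / (1 - inverse c * q ^ Suc r) ^ 2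
            + inverse b * inverse c * q ^ Suc r / (1 - inverse b * inverse c * q ^ Suc r) ^ 2)
      - 6 * (\<Sum>r. q ^ Suc r / (1 - q ^ Suc r) ^ 2)"
proof -
  interpret nome q
    using assms(1,2) by unfold_locales auto
  have b: "b \<notin> powers" "b \<noteq> 0" and c: "c \<notin> powers" "c \<noteq> 0" and bc: "b * c \<notin> powers" "b * c \<noteq> 0"
    using assms by (auto simp: powers_def)
  have inv: "inverse b * inverse c = inverse (b * c)" by simp
  note sums = lambert_split_sums[OF b] lambert_split_sums[OF c] lambert_split_sums[OF bc]
  have "(\<lambda>r. q ^ Suc r / (1 - q ^ Suc r) ^ 2) sums (q * lambert' q)"
    using sums_mult[OF lambert_sums_and_deriv(2)[OF q_in_lambert_dom], of q] by simp
  \<comment> \<open>The facts 3, 7, 11 and 4, 8, 12 of \<open>sums\<close> are the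
    squared-denominator series for \<open>b\<close>, \<open>c\<close>, \<open>b * c\<close>; they
    are added termwise because the right-hand side sums them under one sign.\<close>
  note sums_eqs = sums[THEN sums_unique, symmetric] this[THEN sums_unique, symmetric]
    sums_add[OF sums_add[OF sums(3,7)] sums(11), THEN sums_unique, symmetric]
    sums_add[OF sums_add[OF sums(4,8)] sums(12), THEN sums_unique, symmetric]
  show ?thesis
    unfolding inv sums_eqs using defect_eq_0[OF b bc(1) c]
    by (simp add: defect_def eis1_def eis2_def algebra_simps)
qed

end
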